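(* Let $R$ be a P$v$MD and consider the conditions: (i) $R$ is a weakly Matlis domain; (ii) $R$ has $t$-finite character; (iii) $R$ has the $t\#\#$-property; (iv) $R$ is a $tRTP$-domain. Then (i) $\Rightarrow$ (ii) $\Rightarrow$ (iii) $\Rightarrow$ (iv). If in addition each $t$-prime ideal of $R$ is contained in a unique $t$-maximal ideal, then all four conditions are equivalent.
   Context: $R$ is an integral domain with quotient field $K\neq R$. For nonzero $R$-submodules $A,B$ of $K$, $(A:B)=\{x\in K: xB\subseteq A\}$. For a nonzero fractional ideal $I$, $I_v=(R:(R:I))$, $I_t=\bigcup\{J_v: J\subseteq I\text{ nonzero finitely generated}\}$; $I$ is a $t$-ideal if $I=I_t$; a $t$-prime is a prime $t$-ideal; a $t$-maximal ideal is an ideal maximal among proper $t$-ideals. $R$ is a P$v$MD if $R_M$ is a valuation domain for every $t$-maximal $M$. $R$ has $t$-finite character if each nonzero element of $R$ lies in at most finitely many $t$-maximal ideals. $R$ is weakly Matlis if it has $t$-finite character and each $t$-prime ideal is contained in a unique $t$-maximal ideal. $R$ has the $t\#\#$-property if $\bigcap_{P\in\mathcal P_1}R_P\neq\bigcap_{P\in\mathcal P_2}R_P$ for any two distinct sets $\mathcal P_1,\mathcal P_2$ of pairwise incomparable $t$-primes. $R$ is a $tRTP$-domain if for each nonzero ideal $I$, either $(I(R:I))_t=R$ or $(I(R:I))_t$ is a radical ideal. *)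

theory Defs
  imports Main
begin

text \<open>The ambient field K is the type 'a; R is a subring of K whose quotient field is K.\<close>

definition domain_with_qf :: "'a::field set \<Rightarrow> bool" where
  "domain_with_qf R \<longleftrightarrow> 0 \<in> R \<and> 1 \<in> R \<and>
     (\<forall>a\<in>R. \<forall>b\<in>R. a + b \<in> R \<and> a - b \<in> R \<and> a * b \<in> R) \<and>
     (\<forall>x. \<exists>a\<in>R. \<exists>b\<in>R. b \<noteq> 0 \<and> x = a / b) \<and> R \<noteq> UNIV"

definition submod :: "'a::field set \<Rightarrow> 'a set \<Rightarrow> bool" where
  "submod R A \<longleftrightarrow> 0 \<in> A \<and> (\<forall>x\<in>A. \<forall>y\<in>A. x + y \<in> A) \<and> (\<forall>r\<in>R. \<forall>x\<in>A. r * x \<in> A)"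

definition colon :: "'a::field set \<Rightarrow> 'a set \<Rightarrow> 'a set" where
  "colon A B = {x. \<forall>b\<in>B. x * b \<in> A}"

definition gen :: "'a::field set \<Rightarrow> 'a set \<Rightarrow> 'a set" where
  "gen R F = {x. \<exists>c. (\<forall>f\<in>F. c f \<in> R) \<and> x = (\<Sum>f\<in>F. c f * f)}"

definition mprod :: "'a::field set \<Rightarrow> 'a set \<Rightarrow> 'a set \<Rightarrow> 'a set" where
  "mprod R A B = {x. \<exists>F. finite F \<and> F \<subseteq> {a * b | a b. a \<in> A \<and> b \<in> B} \<and> x \<in> gen R F}"

definition vclos :: "'a::field set \<Rightarrow> 'a set \<Rightarrow> 'a set" where
  "vclos R I = colon R (colon R I)"

definition tclos :: "'a::field set \<Rightarrow> 'a set \<Rightarrow> 'a set" where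
  "tclos R I = \<Union>{vclos R (gen R F) | F. finite F \<and> F \<subseteq> I \<and> gen R F \<noteq> {0}}"

definition ideal_of :: "'a::field set \<Rightarrow> 'a set \<Rightarrow> bool" where
  "ideal_of R I \<longleftrightarrow> I \<subseteq> R \<and> submod R I"

definition t_ideal :: "'a::field set \<Rightarrow> 'a set \<Rightarrow> bool" where
  "t_ideal R I \<longleftrightarrow> ideal_of R I \<and> I \<noteq> {0} \<and> tclos R I = I"

definition prime_ideal_of :: "'a::field set \<Rightarrow> 'a set \<Rightarrow> bool" where
  "prime_ideal_of R P \<longleftrightarrow> ideal_of R P \<and> P \<noteq> R \<and>
     (\<forall>a\<in>R. \<forall>b\<in>R. a * b \<in> P \<longrightarrow> a \<in> P \<or> b \<in> P)"

definition t_prime :: "'a::field set \<Rightarrow> 'a set \<Rightarrow> bool" where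
  "t_prime R P \<longleftrightarrow> prime_ideal_of R P \<and> t_ideal R P"

definition t_maximal :: "'a::field set \<Rightarrow> 'a set \<Rightarrow> bool" where
  "t_maximal R M \<longleftrightarrow> t_ideal R M \<and> M \<noteq> R \<and>
     (\<forall>J. t_ideal R J \<and> J \<noteq> R \<and> M \<subseteq> J \<longrightarrow> J = M)"

definition loc :: "'a::field set \<Rightarrow> 'a set \<Rightarrow> 'a set" where
  "loc R P = {a / s | a s. a \<in> R \<and> s \<in> R \<and> s \<notin> P}"

text \<open>a subring V of K (with quotient field K) is a valuation domain\<close>
definition valuation_ring :: "'a::field set \<Rightarrow> bool" where
  "valuation_ring V \<longleftrightarrow> (\<forall>x. x \<noteq> 0 \<longrightarrow> x \<in> V \<or> inverse x \<in> V)"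

definition PvMD :: "'a::field set \<Rightarrow> bool" where
  "PvMD R \<longleftrightarrow> (\<forall>M. t_maximal R M \<longrightarrow> valuation_ring (loc R M))"

definition t_finite_character :: "'a::field set \<Rightarrow> bool" where
  "t_finite_character R \<longleftrightarrow> (\<forall>x\<in>R. x \<noteq> 0 \<longrightarrow> finite {M. t_maximal R M \<and> x \<in> M})"

definition unique_t_max :: "'a::field set \<Rightarrow> bool" where
  "unique_t_max R \<longleftrightarrow> (\<forall>P. t_prime R P \<longrightarrow> (\<exists>!M. t_maximal R M \<and> P \<subseteq> M))"

definition weakly_Matlis :: "'a::field set \<Rightarrow> bool" where
  "weakly_Matlis R \<longleftrightarrow> t_finite_character R \<and> unique_t_max R"

definition incomparable_t_primes :: "'a::field set \<Rightarrow> 'a set set \<Rightarrow> bool" where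
  "incomparable_t_primes R \<P> \<longleftrightarrow> (\<forall>P\<in>\<P>. t_prime R P) \<and>
     (\<forall>P\<in>\<P>. \<forall>Q\<in>\<P>. P \<subseteq> Q \<longrightarrow> P = Q)"

definition t_sharp_sharp :: "'a::field set \<Rightarrow> bool" where
  "t_sharp_sharp R \<longleftrightarrow> (\<forall>\<P>1 \<P>2. incomparable_t_primes R \<P>1 \<and> incomparable_t_primes R \<P>2 \<and>
     \<P>1 \<noteq> \<P>2 \<longrightarrow> (\<Inter>P\<in>\<P>1. loc R P) \<noteq> (\<Inter>P\<in>\<P>2. loc R P))"

definition radical_ideal :: "'a::field set \<Rightarrow> 'a set \<Rightarrow> bool" where
  "radical_ideal R J \<longleftrightarrow> (\<forall>x\<in>R. \<forall>n::nat. n > 0 \<and> x ^ n \<in> J \<longrightarrow> x \<in> J)"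

definition tRTP :: "'a::field set \<Rightarrow> bool" where
  "tRTP R \<longleftrightarrow> (\<forall>I. ideal_of R I \<and> I \<noteq> {0} \<longrightarrow>
     (let J = tclos R (mprod R I (colon R I)) in J = R \<or> radical_ideal R J))"

end

theory Submission
  imports Defs
begin

text \<open>
  Write R_M for localizations; for t-maximal M these are valuation rings, so every finite set F has
  an element generating F R_M, and the t-closure of any X (the union of the v-closures of its finite
  subsets) generates the same ideal of R_M as X. All arguments are local at t-maximal ideals.

  Finite character implies t##: if the intersection of the R_Q for Q in S is contained in R_P but
  P lies in no Q of S, then, since a nonzero a in P lies in only finitely many Q of S, some finite J in P lies in no Q; a local inverse s/f of J at
  some M above P is in every R_Q but not in R_P.

  From t## every t-prime P contains a finite G such that t-maximal ideals containing G contain P: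
  take an x separating P from the t-maximal ideals not above P and a finite set of v-generators of
  (R : (1,x)). Now let some power of x lie in the t-closure of I(R:I) but x not in I(R:I)R_M, and let
  P be the prime lying under the radical of I(R:I)R_M. Powers of the elements of G are highly
  divisible by x in R_M, which allows one to turn a fraction x/i, multiplying I into P R_P, into
  an element s x/i of (R:I) with s outside M, a contradiction.

  Conversely, if every t-prime lies in a unique t-maximal ideal, tRTP applied to \<open>I = x\<^sup>2 R_M \<inter> R\<close>
  yields for every t-maximal M containing x a y_M with x y_M in R - M and y_M in R_N for all N other than M.
  The elements x and x y_M have t-closure R, so finitely many of them do, and these must involve every M.
\<close>

text \<open>A version of \<open>tclos\<close> for arbitrary sets, without the passage through
  \<open>gen\<close> and without excluding zero modules; by \<open>tclos_eq_tspan\<close> the two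
  agree on every set with a nonzero element.\<close>

definition tspan :: "'a::field set \<Rightarrow> 'a set \<Rightarrow> 'a set" where
  "tspan R X = \<Union>{vclos R F | F. finite F \<and> F \<subseteq> X}"

text \<open>Divisibility of arbitrary field elements in the localization at P.\<close>

definition ldvd :: "'a::field set \<Rightarrow> 'a set \<Rightarrow> 'a \<Rightarrow> 'a \<Rightarrow> bool" where
  "ldvd R P f x \<longleftrightarrow> (\<exists>s\<in>R - P. \<exists>a\<in>R. s * x = a * f)"

section \<open>The v-operation and its finitary version\<close>

locale qf_domain =
  fixes R :: "'a::field set"
  assumes dom: "domain_with_qf R"
begin

lemma zero_R [simp]: "0 \<in> R" and one_R [simp]: "1 \<in> R"
  and add_R: "a \<in> R \<Longrightarrow> b \<in> R \<Longrightarrow> a + b \<in> R"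
  and mult_R: "a \<in> R \<Longrightarrow> b \<in> R \<Longrightarrow> a * b \<in> R"
  and quotient_R: "\<exists>a\<in>R. \<exists>b\<in>R. b \<noteq> 0 \<and> x = a / b"
  and R_not_UNIV: "R \<noteq> UNIV"
  using dom unfolding domain_with_qf_def by auto

lemma power_R: "a \<in> R \<Longrightarrow> a ^ n \<in> R"
  by (induction n) (auto intro: mult_R)

lemma vclosI: "(\<And>y. (\<And>f. f \<in> F \<Longrightarrow> y * f \<in> R) \<Longrightarrow> y * x \<in> R) \<Longrightarrow> x \<in> vclos R F"
  unfolding vclos_def colon_def by (auto simp: mult.commute)

lemma vclosD:
  assumes "x \<in> vclos R F" "\<And>f. f \<in> F \<Longrightarrow> y * f \<in> R"
  shows "y * x \<in> R"
proof -
  have "y \<in> colon R F" using assms(2) by (simp add: colon_def)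
  then have "x * y \<in> R" using assms(1) unfolding vclos_def colon_def[of R "colon R F"] by blast
  then show ?thesis by (simp add: mult.commute)
qed

lemma vclos_incl: "F \<subseteq> vclos R F"
  by (auto intro: vclosI)

lemma vclos_least: "F \<subseteq> vclos R G \<Longrightarrow> vclos R F \<subseteq> vclos R G"
  by (rule subsetI, rule vclosI) (meson subsetD vclosD)

lemma vclos_mono: "F \<subseteq> G \<Longrightarrow> vclos R F \<subseteq> vclos R G"
  using vclos_least vclos_incl by (meson order_trans)

lemma vclos_zero: "0 \<in> vclos R F"
  by (rule vclosI) simp

lemma vclos_add: "x \<in> vclos R F \<Longrightarrow> y \<in> vclos R F \<Longrightarrow> x + y \<in> vclos R F"
  by (rule vclosI) (auto simp: distrib_left intro!: add_R intro: vclosD)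

lemma vclos_mult: 
  assumes "r \<in> R" "x \<in> vclos R F" shows "r * x \<in> vclos R F"
proof (rule vclosI)
  fix y assume "\<And>f. f \<in> F \<Longrightarrow> y * f \<in> R"
  then have "r * (y * x) \<in> R" using mult_R[OF assms(1) vclosD[OF assms(2)]] by blast
  then show "y * (r * x) \<in> R" by (simp add: algebra_simps)
qed

lemma vclos_sum: "(\<And>f. f \<in> A \<Longrightarrow> h f \<in> vclos R F) \<Longrightarrow> (\<Sum>f\<in>A. h f) \<in> vclos R F"
  by (induction A rule: infinite_finite_induct) (auto intro: vclos_zero vclos_add)

text \<open>Multipliers can be shifted: \<open>y * (z * f) = (y * z) * f\<close>. The main use is to
  multiply a relation \<open>1 \<in> vclos R F\<close> by \<open>z\<close>.\<close>

lemma vclos_scale: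
  assumes "x \<in> vclos R F" and "\<And>f. f \<in> F \<Longrightarrow> z * f \<in> vclos R G"
  shows "z * x \<in> vclos R G"
proof (rule vclosI)
  fix y assume y: "\<And>f. f \<in> G \<Longrightarrow> y * f \<in> R"
  have "(y * z) * x \<in> R"
    using assms(1) by (rule vclosD) (use vclosD[OF assms(2) y] in \<open>simp add: mult.assoc\<close>)
  then show "y * (z * x) \<in> R" by (simp add: mult.assoc)
qed

lemma vclos_subset_R: "F \<subseteq> R \<Longrightarrow> vclos R F \<subseteq> R"
proof
  fix x assume "F \<subseteq> R" "x \<in> vclos R F"
  then have "1 * x \<in> R" by (intro vclosD[of x F]) auto
  then show "x \<in> R" by simp
qed

text \<open>As R is not all of K, some \<open>y\<close> lies outside R; the multiplier
  \<open>y / x\<close> sends \<open>F\<close> to 0 but a nonzero \<open>x\<close> out of R.\<close>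

lemma vclos_only_zero:
  assumes "F \<subseteq> {0}" shows "vclos R F = {0}"
proof -
  obtain y where y: "y \<notin> R" using R_not_UNIV by blast
  have "x = 0" if x: "x \<in> vclos R F" for x
  proof (rule ccontr)
    assume "x \<noteq> 0"
    have "y / x * x \<in> R" using x by (rule vclosD) (use assms in auto)
    with \<open>x \<noteq> 0\<close> y show False by simp
  qed
  then show ?thesis using vclos_zero by blast
qed

lemma gen_subset_vclos: "gen R F \<subseteq> vclos R F"
  unfolding gen_def using vclos_incl[of F] by (auto intro!: vclos_sum vclos_mult)

lemma gen_incl: 
  assumes "finite F" shows "F \<subseteq> gen R F"
proof
  fix x assume x: "x \<in> F"
  have "(\<Sum>f\<in>F. (if f = x then 1 else 0) * f) = (\<Sum>f\<in>F. if f = x then f else 0)"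
    by (rule sum.cong) auto
  also have "\<dots> = x" using x assms by simp
  finally show "x \<in> gen R F" unfolding gen_def
    by (auto intro!: exI[of _ "\<lambda>f. if f = x then 1 else 0"])
qed

lemma vclos_gen: "finite F \<Longrightarrow> vclos R (gen R F) = vclos R F"
  using vclos_least[OF gen_subset_vclos] vclos_mono[OF gen_incl] by blast

lemma tspanE:
  assumes "x \<in> tspan R X"
  obtains F where "finite F" "F \<subseteq> X" "x \<in> vclos R F"
  using assms unfolding tspan_def by auto

lemma tspanI: "finite F \<Longrightarrow> F \<subseteq> X \<Longrightarrow> x \<in> vclos R F \<Longrightarrow> x \<in> tspan R X"
  unfolding tspan_def by auto

lemma tspan_incl: "X \<subseteq> tspan R X"
  using vclos_incl by (auto intro!: tspanI[of "{x}" for x])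

lemma tspan_mono: "X \<subseteq> Y \<Longrightarrow> tspan R X \<subseteq> tspan R Y"
  unfolding tspan_def by blast

text \<open>Finitely many finite witnesses unite to a single one. This yields idempotence
  (\<open>tspan_least\<close>) and closure under addition.\<close>

lemma finite_subset_tspan:
  assumes "finite F" "F \<subseteq> tspan R X"
  shows "\<exists>G. finite G \<and> G \<subseteq> X \<and> F \<subseteq> vclos R G"
  using assms
proof (induction F)
  case empty
  then show ?case by blast
next
  case (insert x F)
  then obtain G where G: "finite G" "G \<subseteq> X" "F \<subseteq> vclos R G" by auto
  obtain H where H: "finite H" "H \<subseteq> X" "x \<in> vclos R H" using insert by (auto elim: tspanE)
  have "insert x F \<subseteq> vclos R (G \<union> H)"
    using G H vclos_mono[of G "G \<union> H"] vclos_mono[of H "G \<union> H"] by blast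
  with G H show ?case by (intro exI[of _ "G \<union> H"]) auto
qed

lemma tspan_least: 
  assumes "X \<subseteq> tspan R Y" shows "tspan R X \<subseteq> tspan R Y"
proof
  fix x assume "x \<in> tspan R X"
  then obtain F where F: "finite F" "F \<subseteq> X" "x \<in> vclos R F" by (rule tspanE)
  then obtain G where G: "finite G" "G \<subseteq> Y" "F \<subseteq> vclos R G"
    using finite_subset_tspan[of F Y] assms by blast
  then show "x \<in> tspan R Y" using F vclos_least[of F G] by (auto intro: tspanI)
qed

lemma tspan_zero: "0 \<in> tspan R X"
  by (rule tspanI[of "{}"]) (auto intro: vclos_zero)

lemma tspan_mult: "r \<in> R \<Longrightarrow> x \<in> tspan R X \<Longrightarrow> r * x \<in> tspan R X"
  by (meson tspanE tspanI vclos_mult)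

lemma tspan_add:
  assumes "x \<in> tspan R X" "y \<in> tspan R X" shows "x + y \<in> tspan R X"
  using finite_subset_tspan[of "{x, y}" X] assms by (auto intro!: tspanI vclos_add)

lemma submod_tspan: "submod R (tspan R X)"
  unfolding submod_def by (auto intro: tspan_zero tspan_add tspan_mult)

lemma tspan_subset_R: "X \<subseteq> R \<Longrightarrow> tspan R X \<subseteq> R"
  unfolding tspan_def using vclos_subset_R by blast

lemma gen_eq_zero_iff: "finite F \<Longrightarrow> gen R F = {0} \<longleftrightarrow> F \<subseteq> {0}"
proof
  assume "finite F" "gen R F = {0}" then show "F \<subseteq> {0}" using gen_incl by blast
next
  assume "finite F" "F \<subseteq> {0}"
  then show "gen R F = {0}" using gen_subset_vclos[of F] vclos_only_zero[of F] 
    by (auto simp: gen_def intro!: exI[of _ "\<lambda>_. 0"])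
qed

lemma tclos_eq_tspan:
  assumes "x \<in> I" "x \<noteq> 0" shows "tclos R I = tspan R I"
proof
  show "tclos R I \<subseteq> tspan R I"
    unfolding tclos_def using vclos_gen by (auto intro: tspanI)
next
  show "tspan R I \<subseteq> tclos R I"
  proof
    fix z assume "z \<in> tspan R I"
    then obtain F where F: "finite F" "F \<subseteq> I" "z \<in> vclos R F" by (rule tspanE)
    \<comment> \<open>Adjoining \<open>x\<close> only enlarges the v-closure and makes the generated
      module nonzero, as \<open>tclos\<close> demands.\<close>
    have "z \<in> vclos R (gen R (insert x F))"
      using F vclos_mono[of F "insert x F"] by (auto simp: vclos_gen)
    moreover have "gen R (insert x F) \<noteq> {0}" using F assms by (simp add: gen_eq_zero_iff)
    moreover have "finite (insert x F)" "insert x F \<subseteq> I" using F assms by auto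
    ultimately show "z \<in> tclos R I" unfolding tclos_def by blast
  qed
qed

text \<open>Sums of products already lie in the t-span of the products, so later arguments on I(R:I)
  handle single products only.\<close>

lemma tclos_mprod:
  assumes "a \<in> A" "b \<in> B" "a * b \<noteq> 0"
  shows "tclos R (mprod R A B) = tspan R {a * b | a b. a \<in> A \<and> b \<in> B}" (is "_ = tspan R ?X")
proof -
  have sub: "?X \<subseteq> mprod R A B"
  proof
    fix x assume "x \<in> ?X"
    then have "finite {x}" "{x} \<subseteq> ?X" "x \<in> gen R {x}" using gen_incl[of "{x}"] by auto
    then show "x \<in> mprod R A B" unfolding mprod_def by blast
  qed
  have "mprod R A B \<subseteq> tspan R ?X"
  proof
    fix x assume "x \<in> mprod R A B"
    then obtain F where F: "finite F" "F \<subseteq> ?X" "x \<in> gen R F" unfolding mprod_def by blast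
    then have "x \<in> vclos R F" using gen_subset_vclos by blast
    with F show "x \<in> tspan R ?X" by (intro tspanI)
  qed
  then have "tspan R (mprod R A B) = tspan R ?X"
    using tspan_least tspan_mono[OF sub] by blast
  moreover have "a * b \<in> mprod R A B" using assms sub by blast
  ultimately show ?thesis using tclos_eq_tspan assms(3) by metis
qed

section \<open>t-ideals and t-maximal ideals\<close>

lemma t_ideal_iff: "t_ideal R I \<longleftrightarrow> I \<subseteq> R \<and> (\<exists>x\<in>I. x \<noteq> 0) \<and> tspan R I \<subseteq> I"
proof
  assume I: "t_ideal R I"
  then obtain x where "x \<in> I" "x \<noteq> 0" unfolding t_ideal_def ideal_of_def submod_def by blast
  with I show "I \<subseteq> R \<and> (\<exists>x\<in>I. x \<noteq> 0) \<and> tspan R I \<subseteq> I"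
    unfolding t_ideal_def ideal_of_def using tclos_eq_tspan by blast
next
  assume I: "I \<subseteq> R \<and> (\<exists>x\<in>I. x \<noteq> 0) \<and> tspan R I \<subseteq> I"
  then have "tspan R I = I" using tspan_incl by blast
  with I show "t_ideal R I"
    unfolding t_ideal_def ideal_of_def using tclos_eq_tspan submod_tspan[of I] by auto
qed

lemma t_ideal_vclos: "t_ideal R I \<Longrightarrow> finite F \<Longrightarrow> F \<subseteq> I \<Longrightarrow> vclos R F \<subseteq> I"
  unfolding t_ideal_iff tspan_def by blast

lemma t_ideal_mult: "t_ideal R I \<Longrightarrow> r \<in> R \<Longrightarrow> x \<in> I \<Longrightarrow> r * x \<in> I"
  unfolding t_ideal_def ideal_of_def submod_def by blast

lemma t_ideal_eq_R_iff: "t_ideal R I \<Longrightarrow> I = R \<longleftrightarrow> 1 \<in> I"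
  using t_ideal_mult[of I _ 1] unfolding t_ideal_iff by auto

text \<open>Zorn's lemma applies because \<open>tspan\<close> is finitary: a finite subset of the
  union of a chain lies in one member.\<close>

lemma ex_t_maximal_superset:
  assumes X: "X \<subseteq> R" and x: "x \<in> X" "x \<noteq> 0" and one: "1 \<notin> tspan R X"
  shows "\<exists>M. t_maximal R M \<and> X \<subseteq> M"
proof -
  define \<A> where "\<A> = {J. t_ideal R J \<and> 1 \<notin> J \<and> X \<subseteq> J}"
  have "tspan R X \<in> \<A>"
    unfolding \<A>_def t_ideal_iff using assms tspan_subset_R tspan_incl[of X] tspan_least[of "tspan R X" X] 
    by auto
  moreover have "\<Union>C \<in> \<A>" if C: "C \<noteq> {}" "subset.chain \<A> C" for C
  proof -
    have "tspan R (\<Union>C) \<subseteq> \<Union>C"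
    proof
      fix z assume "z \<in> tspan R (\<Union>C)"
      then obtain F where F: "finite F" "F \<subseteq> \<Union>C" "z \<in> vclos R F" by (rule tspanE)
      obtain J where "J \<in> C" "F \<subseteq> J"
        using finite_subset_Union_chain[OF F(1,2) C(1,2)] by blast
      moreover have "t_ideal R J" using C \<open>J \<in> C\<close> unfolding subset.chain_def \<A>_def by blast
      ultimately show "z \<in> \<Union>C" using F t_ideal_vclos by blast
    qed
    moreover obtain J where J: "J \<in> C" using C(1) by blast
    moreover have C': "t_ideal R J" "1 \<notin> J" "X \<subseteq> J" if "J \<in> C" for J
      using C(2) that unfolding \<A>_def subset.chain_def by auto
    moreover have "\<Union>C \<subseteq> R" using C' unfolding t_ideal_iff by blast
    ultimately show ?thesis using x unfolding \<A>_def t_ideal_iff by blast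
  qed
  ultimately obtain M where M: "M \<in> \<A>" "\<forall>J\<in>\<A>. M \<subseteq> J \<longrightarrow> J = M"
    using subset_Zorn_nonempty[of \<A>] by blast
  have "t_maximal R M" unfolding t_maximal_def
  proof (intro conjI allI impI)
    show "t_ideal R M" "M \<noteq> R" using M by (auto simp: \<A>_def)
    fix J assume "t_ideal R J \<and> J \<noteq> R \<and> M \<subseteq> J"
    then show "J = M" using M t_ideal_eq_R_iff[of J] by (auto simp: \<A>_def)
  qed
  then show ?thesis using M by (auto simp: \<A>_def)
qed

lemma t_maximalD:
  assumes "t_maximal R M"
  shows "t_ideal R M" "M \<subseteq> R" "1 \<notin> M" "tspan R M = M"
proof -
  show I: "t_ideal R M" using assms by (simp add: t_maximal_def)
  then show "M \<subseteq> R" "tspan R M = M" using tspan_incl[of M] by (auto simp: t_ideal_iff)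
  show "1 \<notin> M" using assms I by (auto simp: t_maximal_def t_ideal_eq_R_iff)
qed

lemma ex_t_maximal: "\<exists>M. t_maximal R M"
proof -
  obtain y where y: "y \<notin> R" using R_not_UNIV by blast
  obtain a b where ab: "a \<in> R" "b \<in> R" "b \<noteq> 0" "y = a / b" using quotient_R by blast
  have "1 \<notin> tspan R {b}"
  proof
    assume "1 \<in> tspan R {b}"
    then obtain F where F: "F \<subseteq> {b}" "1 \<in> vclos R F" by (rule tspanE)
    \<comment> \<open>If 1 were in the span of \<open>b\<close>, then \<open>b\<close> would be a
      unit of R, contradicting that \<open>a / b\<close> is outside R.\<close>
    have "inverse b * 1 \<in> R" using F(2) by (rule vclosD) (use F ab in auto)
    then have "a * inverse b \<in> R" using ab by (auto intro: mult_R)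
    with y ab show False by (simp add: field_simps)
  qed
  then show ?thesis using ex_t_maximal_superset[of "{b}" b] ab by auto
qed

text \<open>For \<open>a\<close> outside \<open>M\<close>, maximality puts 1 into the t-span of
  \<open>insert a M\<close>; multiplication by \<open>b\<close> moves all generators into
  \<open>M\<close>, hence also \<open>b\<close>.\<close>

lemma t_maximal_prime:
  assumes M: "t_maximal R M"
  shows "prime_ideal_of R M"
proof -
  note MD = t_maximalD[OF M]
  have "b \<in> M" if ab: "a \<in> R" "b \<in> R" "a * b \<in> M" "a \<notin> M" for a b
  proof -
    have "1 \<in> tspan R (insert a M)"
    proof (rule ccontr)
      assume "1 \<notin> tspan R (insert a M)"
      moreover obtain m where "m \<in> M" "m \<noteq> 0" using MD(1) by (auto simp: t_ideal_iff)
      ultimately obtain N where "t_maximal R N" "insert a M \<subseteq> N"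
        using ex_t_maximal_superset[of "insert a M" m] MD ab by auto
      then show False using M ab(4) unfolding t_maximal_def by blast
    qed
    then obtain F where F: "finite F" "F \<subseteq> insert a M" "1 \<in> vclos R F" by (rule tspanE)
    have "b * 1 \<in> vclos R ((*) b ` F)" 
      by (rule vclos_scale[OF F(3)]) (use vclos_incl[of "(*) b ` F"] in blast)
    moreover have "(*) b ` F \<subseteq> M"
      using F(2) ab(2,3) t_ideal_mult[OF MD(1) ab(2)] by (auto simp: mult.commute[of b a])
    ultimately show "b \<in> M" using t_ideal_vclos[OF MD(1), of "(*) b ` F"] F(1) by auto
  qed
  then show ?thesis using MD(1,3) unfolding prime_ideal_of_def t_ideal_def by auto
qed

lemma one_in_tspan:
  assumes "X \<subseteq> R" and "\<And>M. t_maximal R M \<Longrightarrow> \<not> X \<subseteq> M"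
  shows "1 \<in> tspan R X"
\<comment> \<open>\<open>ex_t_maximal_superset\<close> requires a nonzero element. A set inside
  \<open>{0}\<close> is ruled out since 0 lies in some t-maximal ideal.\<close>
proof (cases "X \<subseteq> {0}")
  case True
  obtain M where M: "t_maximal R M" using ex_t_maximal by blast
  then have "0 \<in> M" using tspan_zero[of M] t_maximalD by simp
  then show ?thesis using assms(2)[OF M] True by blast
next
  case False
  then show ?thesis using ex_t_maximal_superset[of X] assms by blast
qed

text \<open>The denominators \<open>r\<close> with \<open>r * x\<close> in the t-span lie in no
  common t-maximal ideal, so they t-span 1; multiplying that relation by \<open>x\<close> gives the
  claim.\<close>

lemma local_global:
  assumes "\<And>M. t_maximal R M \<Longrightarrow> \<exists>s\<in>R - M. s * x \<in> tspan R A"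
  shows "x \<in> tspan R A"
proof -
  let ?X = "{r \<in> R. r * x \<in> tspan R A}"
  have "1 \<in> tspan R ?X" using assms by (intro one_in_tspan) blast+
  then obtain F where F: "finite F" "F \<subseteq> ?X" "1 \<in> vclos R F" by (rule tspanE)
  have "(*) x ` F \<subseteq> tspan R A" using F by (auto simp: mult.commute)
  moreover have "x * 1 \<in> vclos R ((*) x ` F)"
    by (rule vclos_scale[OF F(3)]) (use vclos_incl[of "(*) x ` F"] in blast)
  ultimately have "x \<in> tspan R (tspan R A)" using F(1) by (auto intro: tspanI)
  then show ?thesis using tspan_least[of "tspan R A" A] by blast
qed

lemma local_global_R:
  assumes "\<And>M. t_maximal R M \<Longrightarrow> ldvd R M 1 x"
  shows "x \<in> R"
proof -
  have "x \<in> tspan R R"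
    by (rule local_global) (use assms tspan_incl[of R] in \<open>force simp: ldvd_def\<close>)
  then show ?thesis using tspan_subset_R by blast
qed

section \<open>Primes and divisibility in localizations\<close>

lemma primeD:
  assumes "prime_ideal_of R P"
  shows "P \<subseteq> R" "0 \<in> P" "1 \<notin> P" "\<And>r x. r \<in> R \<Longrightarrow> x \<in> P \<Longrightarrow> r * x \<in> P"
    "\<And>a b. a \<in> R \<Longrightarrow> b \<in> R \<Longrightarrow> a * b \<in> P \<Longrightarrow> a \<in> P \<or> b \<in> P"
    "\<And>s u. s \<in> R - P \<Longrightarrow> u \<in> R - P \<Longrightarrow> s * u \<in> R - P"
proof -
  show "P \<subseteq> R" "0 \<in> P" and m: "\<And>r x. r \<in> R \<Longrightarrow> x \<in> P \<Longrightarrow> r * x \<in> P"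
    and p: "\<And>a b. a \<in> R \<Longrightarrow> b \<in> R \<Longrightarrow> a * b \<in> P \<Longrightarrow> a \<in> P \<or> b \<in> P"
    using assms unfolding prime_ideal_of_def ideal_of_def submod_def by auto
  show "1 \<notin> P" using assms m[of _ 1] unfolding prime_ideal_of_def ideal_of_def by auto
  show "s * u \<in> R - P" if "s \<in> R - P" "u \<in> R - P" for s u using p[of s u] that mult_R by auto
qed

lemma prime_power:
  assumes "prime_ideal_of R P" "x \<in> R" "x ^ n \<in> P" shows "x \<in> P"
  using assms(3)
proof (induction n)
  case 0
  then show ?case using primeD(3)[OF assms(1)] by simp
next
  case (Suc n)
  then show ?case using primeD(5)[OF assms(1), of x "x ^ n"] assms(2) power_R by auto
qed

lemma loc_iff_ldvd:
  assumes "prime_ideal_of R P" shows "x \<in> loc R P \<longleftrightarrow> ldvd R P 1 x"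
proof
  assume "x \<in> loc R P"
  then obtain a s where "a \<in> R" "s \<in> R" "s \<notin> P" "x = a / s" unfolding loc_def by auto
  moreover have "s \<noteq> 0" using primeD(2)[OF assms] \<open>s \<notin> P\<close> by auto
  ultimately show "ldvd R P 1 x" unfolding ldvd_def by (intro bexI[of _ s] bexI[of _ a]) auto
next
  assume "ldvd R P 1 x"
  then obtain a s where as: "a \<in> R" "s \<in> R" "s \<notin> P" "s * x = a" unfolding ldvd_def by auto
  then have "s \<noteq> 0" using primeD(2)[OF assms] by auto
  then have "x = a / s" using as by (simp add: field_simps)
  then show "x \<in> loc R P" unfolding loc_def using as by blast
qed

lemma ldvdI: "s \<in> R \<Longrightarrow> s \<notin> P \<Longrightarrow> a \<in> R \<Longrightarrow> s * x = a * f \<Longrightarrow> ldvd R P f x"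
  unfolding ldvd_def by blast

lemma ldvd_subset: "ldvd R M f x \<Longrightarrow> P \<subseteq> M \<Longrightarrow> ldvd R P f x"
  unfolding ldvd_def by blast

lemma ldvd_trans:
  assumes P: "prime_ideal_of R P" and "ldvd R P f g" "ldvd R P g h"
  shows "ldvd R P f h"
proof -
  obtain s a where 1: "s \<in> R - P" "a \<in> R" "s * g = a * f" using assms unfolding ldvd_def by blast
  obtain t b where 2: "t \<in> R - P" "b \<in> R" "t * h = b * g" using assms unfolding ldvd_def by blast
  have "(s * t) * h = b * (s * g)" using 2(3) by (simp add: algebra_simps)
  also have "\<dots> = (b * a) * f" using 1(3) by (simp add: algebra_simps)
  finally show ?thesis using 1 2 primeD(6)[OF P, of s t] by (auto intro!: ldvdI[of "s * t" _ "b * a"] mult_R)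
qed

lemma ldvd_scale: "ldvd R P f x \<Longrightarrow> ldvd R P (z * f) (z * x)"
  unfolding ldvd_def by (metis mult.left_commute)

lemma ldvd_mult:
  assumes P: "prime_ideal_of R P" and "ldvd R P f x" "ldvd R P g y"
  shows "ldvd R P (f * g) (x * y)"
proof -
  have "ldvd R P (f * g) (f * y)" using assms(3) by (rule ldvd_scale)
  moreover have "ldvd R P (f * y) (x * y)"
    using ldvd_scale[OF assms(2), of y] by (simp add: mult.commute)
  ultimately show ?thesis by (rule ldvd_trans[OF P])
qed

lemma ldvd_refl: "prime_ideal_of R P \<Longrightarrow> ldvd R P f f"
  using primeD(3) by (auto intro!: ldvdI[of 1 _ 1])

lemma ldvd_power:
  assumes P: "prime_ideal_of R P" and "ldvd R P f x"
  shows "ldvd R P (f ^ n) (x ^ n)"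
  by (induction n) (auto intro: ldvd_refl ldvd_mult assms)

lemma ldvd_add:
  assumes P: "prime_ideal_of R P" and "ldvd R P f x" "ldvd R P f y"
  shows "ldvd R P f (x + y)"
proof -
  obtain s a where 1: "s \<in> R - P" "a \<in> R" "s * x = a * f" using assms unfolding ldvd_def by blast
  obtain t b where 2: "t \<in> R - P" "b \<in> R" "t * y = b * f" using assms unfolding ldvd_def by blast
  have "(s * t) * (x + y) = t * (s * x) + s * (t * y)" by (simp add: algebra_simps)
  also have "\<dots> = (t * a + s * b) * f" unfolding 1(3) 2(3) by (simp add: algebra_simps)
  finally have "(s * t) * (x + y) = (t * a + s * b) * f" .
  moreover have "t * a + s * b \<in> R" using 1 2 by (auto intro!: mult_R add_R)
  ultimately show ?thesis using primeD(6)[OF P 1(1) 2(1)] unfolding ldvd_def by blast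
qed

lemma ldvd_common_denominator:
  assumes P: "prime_ideal_of R P" and "finite F" "\<And>g. g \<in> F \<Longrightarrow> ldvd R P f g"
  shows "\<exists>s\<in>R - P. \<forall>g\<in>F. \<exists>a\<in>R. s * g = a * f"
  using assms(2,3)
proof (induction F)
  case empty
  then show ?case using primeD(3)[OF P] one_R by blast
next
  case (insert h F)
  then obtain s where s: "s \<in> R - P" "\<forall>g\<in>F. \<exists>a\<in>R. s * g = a * f" by auto
  obtain t b where t: "t \<in> R - P" "b \<in> R" "t * h = b * f"
    using insert.prems[of h] unfolding ldvd_def by blast
  have "\<exists>a\<in>R. (s * t) * g = a * f" if g: "g \<in> insert h F" for g
  proof (cases "g = h")
    case True
    then have "(s * t) * g = (s * b) * f" using t by (simp add: mult.assoc)
    then show ?thesis using s t mult_R by blast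
  next
    case False
    then obtain a where a: "a \<in> R" "s * g = a * f" using g s by blast
    then have "(s * t) * g = (t * a) * f" by (simp add: algebra_simps)
    then show ?thesis using a t mult_R by blast
  qed
  then show ?case using primeD(6)[OF P s(1) t(1)] by blast
qed

lemma t_prime_subset_t_maximal:
  assumes "t_prime R P" shows "\<exists>M. t_maximal R M \<and> P \<subseteq> M"
proof -
  have P: "P \<subseteq> R" "tspan R P \<subseteq> P" "\<exists>x\<in>P. x \<noteq> 0" "1 \<notin> P"
    using assms primeD(3)[of P] unfolding t_prime_def t_ideal_iff by auto
  then show ?thesis using ex_t_maximal_superset[of P] by blast
qed

end

section \<open>Valuation arguments at t-maximal ideals\<close>

locale PvMD_domain = qf_domain +
  assumes PvMD: "PvMD R"
begin

lemma ldvd_total_t_maximal: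
  assumes M: "t_maximal R M"
  shows "ldvd R M f g \<or> ldvd R M g f"
proof (cases "f = 0 \<or> g = 0")
  case True
  then show ?thesis using t_maximalD[OF M] by (auto intro: ldvdI[of 1 _ 0])
next
  case False
  note prime = t_maximal_prime[OF M]
  have "g / f \<in> loc R M \<or> f / g \<in> loc R M"
    using PvMD M False unfolding PvMD_def valuation_ring_def
    by (metis divide_eq_0_iff inverse_divide)
  then have "ldvd R M 1 (g / f) \<or> ldvd R M 1 (f / g)" using loc_iff_ldvd[OF prime] by blast
  then show ?thesis using ldvd_scale[of M 1 "g / f" f] ldvd_scale[of M 1 "f / g" g] False by auto
qed

text \<open>Comparability holds in R_M for a t-maximal \<open>M\<close> above \<open>P\<close> and
  passes to the overring R_P.\<close>

lemma ldvd_total: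
  assumes "t_prime R P" shows "ldvd R P f g \<or> ldvd R P g f"
  using t_prime_subset_t_maximal[OF assms] ldvd_total_t_maximal ldvd_subset by blast

lemma not_ldvdD:
  assumes "t_prime R P" "\<not> ldvd R P f g"
  shows "\<exists>p\<in>P. \<exists>u\<in>R - P. u * f = p * g"
  using ldvd_total[OF assms(1), of f g] assms(2) unfolding ldvd_def by (metis Diff_iff)

text \<open>This expresses P R_P \<subseteq> R_N: all fractions \<open>p / u\<close> lie in R_N.
  Otherwise \<open>u\<close> would be a multiple of \<open>p\<close> in R_N, hence in
  \<open>P\<close>.\<close>

lemma ldvd_of_mem_prime:
  assumes N: "t_maximal R N" and P: "prime_ideal_of R P" "P \<subseteq> N" and p: "p \<in> P" and u: "u \<in> R - P"
  shows "ldvd R N u p"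
proof (rule ccontr)
  assume "\<not> ldvd R N u p"
  then obtain s a where "s \<in> R - N" "a \<in> R" "s * u = a * p"
    using ldvd_total_t_maximal[OF N, of u p] unfolding ldvd_def by blast
  then show False using primeD(4)[OF P(1) _ p, of a] primeD(6)[OF P(1), of s u] P(2) u by auto
qed

lemma ldvd_least:
  assumes M: "t_maximal R M" and "finite F" "F \<noteq> {}"
  shows "\<exists>f\<in>F. \<forall>g\<in>F. ldvd R M f g"
  using assms(2,3)
proof (induction F rule: finite_ne_induct)
  case (singleton x)
  then show ?case using ldvd_refl[OF t_maximal_prime[OF M]] by simp
next
  case (insert x F)
  then obtain f where f: "f \<in> F" "\<forall>g\<in>F. ldvd R M f g" by blast
  show ?case
  proof (cases "ldvd R M f x")
    case True
    with f show ?thesis by blast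
  next
    case False
    then have "ldvd R M x f" using ldvd_total_t_maximal[OF M] by blast
    then have "\<forall>g\<in>insert x F. ldvd R M x g"
      using f ldvd_trans[OF t_maximal_prime[OF M]] ldvd_refl[OF t_maximal_prime[OF M]] by blast
    then show ?thesis by blast
  qed
qed

text \<open>The common denominator \<open>s\<close> makes \<open>s / f\<close> a multiplier of all
  of \<open>F\<close> into R, which links local generators to v-closures.\<close>

lemma finite_local_generator:
  assumes M: "t_maximal R M" and F: "finite F" and x: "x \<in> F" "x \<noteq> 0"
  shows "\<exists>f\<in>F. f \<noteq> 0 \<and> (\<exists>s\<in>R - M. \<forall>g\<in>F. \<exists>a\<in>R. s * g = a * f)"
proof -
  obtain f where f: "f \<in> F" "\<forall>g\<in>F. ldvd R M f g" using ldvd_least[OF M F] x by blast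
  obtain s where s: "s \<in> R - M" "\<forall>g\<in>F. \<exists>a\<in>R. s * g = a * f"
    using ldvd_common_denominator[OF t_maximal_prime[OF M] F, of f] f by blast
  have "s \<noteq> 0" using s primeD(2)[OF t_maximal_prime[OF M]] by auto
  then have "f \<noteq> 0" using s(2) x by force
  with f s show ?thesis by blast
qed

text \<open>The multiplier \<open>s / f\<close> of a finite \<open>F\<close> into R also multiplies
  the v-closure of \<open>F\<close> into R. Hence t-closure does not enlarge the ideal generated in
  R_M.\<close>

lemma tspan_local:
  assumes M: "t_maximal R M" and x: "x \<in> tspan R X" "x \<noteq> 0"
  shows "\<exists>f\<in>X. ldvd R M f x"
proof -
  obtain F where F: "finite F" "F \<subseteq> X" "x \<in> vclos R F" using x(1) by (rule tspanE)
  have "\<not> F \<subseteq> {0}" using vclos_only_zero[of F] F x by auto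
  then obtain g where "g \<in> F" "g \<noteq> 0" by blast
  then obtain f s where f: "f \<in> F" "f \<noteq> 0" "s \<in> R - M" "\<forall>g\<in>F. \<exists>a\<in>R. s * g = a * f"
    using finite_local_generator[OF M F(1)] by blast
  have "(s / f) * x \<in> R"
  proof (rule vclosD[OF F(3)])
    fix g assume "g \<in> F"
    then obtain a where "a \<in> R" "s * g = a * f" using f by blast
    then show "s / f * g \<in> R" using f(2) by simp
  qed
  moreover have "s * x = ((s / f) * x) * f" using f(2) by simp
  ultimately have "ldvd R M f x" using f(3) unfolding ldvd_def by blast
  then show ?thesis using f F by blast
qed

text \<open>By \<open>tspan_local\<close> an element of the t-span of \<open>P\<close> is a multiple
  of some \<open>f\<close> in \<open>P\<close> up to a denominator outside \<open>M\<close>, and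
  primality removes the denominator.\<close>

lemma prime_subset_t_maximal_t_prime:
  assumes M: "t_maximal R M" and P: "prime_ideal_of R P" "P \<subseteq> M" and p: "p \<in> P" "p \<noteq> 0"
  shows "t_prime R P"
proof -
  have "tspan R P \<subseteq> P"
  proof
    fix x assume x: "x \<in> tspan R P"
    show "x \<in> P"
    proof (cases "x = 0")
      case True
      then show ?thesis using primeD(2)[OF P(1)] by simp
    next
      case False
      then obtain f where "f \<in> P" "ldvd R M f x" using tspan_local[OF M x] by blast
      then obtain s a where "s \<in> R - M" "a \<in> R" "s * x = a * f" unfolding ldvd_def by blast
      moreover have "x \<in> R" using x tspan_subset_R primeD(1)[OF P(1)] by blast
      ultimately show ?thesis
        using primeD(4)[OF P(1) _ \<open>f \<in> P\<close>, of a] primeD(5)[OF P(1), of s x] P(2) by auto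
    qed
  qed
  then show ?thesis using P p primeD(1)[OF P(1)] unfolding t_prime_def t_ideal_iff by blast
qed

lemma t_primes_in_t_maximal_comparable:
  assumes M: "t_maximal R M" and P: "prime_ideal_of R P" "P \<subseteq> M" and Q: "prime_ideal_of R Q" "Q \<subseteq> M"
  shows "P \<subseteq> Q \<or> Q \<subseteq> P"
proof (rule ccontr)
  assume "\<not> (P \<subseteq> Q \<or> Q \<subseteq> P)"
  then obtain p q where pq: "p \<in> P" "p \<notin> Q" "q \<in> Q" "q \<notin> P" by blast
  have "ldvd R M q p" using ldvd_of_mem_prime[OF M P pq(1), of q] pq primeD(1)[OF Q(1)] by blast
  then obtain s a where "s \<in> R - M" "a \<in> R" "s * p = a * q" unfolding ldvd_def by blast
  then show False
    using primeD(4)[OF Q(1) _ pq(3), of a] primeD(6)[OF Q(1), of s p] pq primeD(1)[OF P(1)] Q(2) by auto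
qed

text \<open>\<open>P\<close> is the contraction of the radical of the ideal X R_M. Principal ideals
  of a valuation ring form a chain, so single elements \<open>f\<close> of \<open>X\<close> suffice
  and this radical is prime.\<close>

lemma local_radical_t_prime:
  fixes M X
  defines "P \<equiv> {z \<in> R. \<exists>n. \<exists>f\<in>X. ldvd R M f (z ^ n)}"
  assumes M: "t_maximal R M" and X: "X \<subseteq> M" "x \<in> X" "x \<noteq> 0"
  shows "t_prime R P" "P \<subseteq> M"
proof -
  note prime = t_maximal_prime[OF M]
  have XR: "X \<subseteq> R" using X(1) primeD(1)[OF prime] by blast
  have PI: "z \<in> P" if "z \<in> R" "w \<in> P" "ldvd R M w z" for z w
  proof -
    obtain n f where "f \<in> X" "ldvd R M f (w ^ n)" using \<open>w \<in> P\<close> unfolding P_def by blast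
    then have "ldvd R M f (z ^ n)"
      using ldvd_trans[OF prime _ ldvd_power[OF prime \<open>ldvd R M w z\<close>]] by blast
    then show ?thesis using \<open>f \<in> X\<close> \<open>z \<in> R\<close> unfolding P_def by blast
  qed
  have XP: "X \<subseteq> P"
  proof
    fix z assume "z \<in> X"
    moreover have "ldvd R M z (z ^ 1)" using ldvd_refl[OF prime] by simp
    ultimately show "z \<in> P" using XR unfolding P_def by blast
  qed
  show PM: "P \<subseteq> M"
  proof
    fix z assume "z \<in> P"
    then obtain n f where z: "z \<in> R" "f \<in> X" "ldvd R M f (z ^ n)" unfolding P_def by blast
    then obtain s a where "s \<in> R - M" "a \<in> R" "s * z ^ n = a * f" unfolding ldvd_def by blast
    moreover have "f \<in> M" using z X by blast
    ultimately have "z ^ n \<in> M"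
      using primeD(4)[OF prime, of a f] primeD(5)[OF prime, of s "z ^ n"] z power_R by auto
    then show "z \<in> M" using prime_power[OF prime] z by blast
  qed
  have add: "a + b \<in> P" if ab: "a \<in> P" "b \<in> P" for a b
  proof -
    have "a \<in> R" "b \<in> R" using ab unfolding P_def by auto
    then have sum: "a + b \<in> R" by (rule add_R)
    show ?thesis
      using ldvd_total_t_maximal[OF M, of a b] ldvd_refl[OF prime] ldvd_add[OF prime] PI[OF sum] ab by metis
  qed
  have mult: "r * a \<in> P" if "r \<in> R" "a \<in> P" for r a
  proof (rule PI[OF _ \<open>a \<in> P\<close>])
    show "r * a \<in> R" using that mult_R unfolding P_def by blast
    show "ldvd R M a (r * a)" using that primeD(3)[OF prime] by (intro ldvdI[of 1 _ r]) auto
  qed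
  have pow: "a \<in> P" if "a \<in> R" "a * a \<in> P" for a
  proof -
    obtain n f where "f \<in> X" "ldvd R M f ((a * a) ^ n)" using \<open>a * a \<in> P\<close> unfolding P_def by blast
    then have "ldvd R M f (a ^ (n + n))" by (simp add: power_add power_mult_distrib)
    then show ?thesis using \<open>f \<in> X\<close> \<open>a \<in> R\<close> unfolding P_def by blast
  qed
  \<comment> \<open>If \<open>a\<close> divides \<open>b\<close> locally, then \<open>a * b\<close>
    divides \<open>b * b\<close>, so the square of one factor lies in \<open>P\<close>.\<close>
  have prm: "a \<in> P \<or> b \<in> P" if ab: "a \<in> R" "b \<in> R" "a * b \<in> P" for a b
    using ldvd_total_t_maximal[OF M, of a b]
  proof
    assume "ldvd R M a b"
    then have "ldvd R M (a * b) (b * b)" using ldvd_scale[of M a b b] by (simp add: mult.commute)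
    then show ?thesis using PI[OF mult_R ab(3)] ab pow by blast
  next
    assume "ldvd R M b a"
    then have "ldvd R M (a * b) (a * a)" by (rule ldvd_scale)
    then show ?thesis using PI[OF mult_R ab(3)] ab pow by blast
  qed
  have "0 \<in> P" using mult[of 0 x] XP X by auto
  moreover have "P \<subseteq> R" unfolding P_def by blast
  moreover have "P \<noteq> R" using PM primeD(3)[OF prime] one_R by blast
  ultimately have "prime_ideal_of R P"
    unfolding prime_ideal_of_def ideal_of_def submod_def using add mult prm by blast
  then show "t_prime R P"
    using prime_subset_t_maximal_t_prime[OF M _ PM, of x] XP X by blast
qed

section \<open>Finite character implies the t##-property\<close>

lemma finite_char_intersection_subset_loc:
  assumes fc: "t_finite_character R" and S: "incomparable_t_primes R S" and P: "t_prime R P"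
    and sub: "(\<Inter>Q\<in>S. loc R Q) \<subseteq> loc R P"
  shows "\<exists>Q\<in>S. P \<subseteq> Q"
proof (rule ccontr)
  assume neg: "\<not> (\<exists>Q\<in>S. P \<subseteq> Q)"
  have Pp: "prime_ideal_of R P" using P by (simp add: t_prime_def)
  obtain a where a: "a \<in> P" "a \<noteq> 0" "a \<in> R" using P by (auto simp: t_prime_def t_ideal_iff)
  have Sp: "t_prime R Q" "prime_ideal_of R Q" if "Q \<in> S" for Q
    using that S by (auto simp: incomparable_t_primes_def t_prime_def)
  \<comment> \<open>Primes below one t-maximal ideal are comparable, so incomparability makes
    \<open>mx\<close> injective. Finite character at \<open>a\<close> then leaves only finitely many
    members of \<open>S\<close> containing \<open>a\<close>.\<close>
  define mx where "mx Q = (SOME M. t_maximal R M \<and> Q \<subseteq> M)" for Q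
  have mx: "t_maximal R (mx Q)" "Q \<subseteq> mx Q" if "Q \<in> S" for Q
    unfolding mx_def using someI_ex[OF t_prime_subset_t_maximal[OF Sp(1)[OF that]]] by auto
  have "inj_on mx {Q \<in> S. a \<in> Q}"
  proof (rule inj_onI)
    fix Q Q' assume Q: "Q \<in> {Q \<in> S. a \<in> Q}" "Q' \<in> {Q \<in> S. a \<in> Q}" "mx Q = mx Q'"
    then have "Q \<subseteq> Q' \<or> Q' \<subseteq> Q"
      using t_primes_in_t_maximal_comparable[of "mx Q" Q Q'] mx[of Q] mx[of Q'] Sp by auto
    then show "Q = Q'" using S Q unfolding incomparable_t_primes_def by blast
  qed
  moreover have "mx ` {Q \<in> S. a \<in> Q} \<subseteq> {M. t_maximal R M \<and> a \<in> M}" using mx by blast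
  moreover have "finite {M. t_maximal R M \<and> a \<in> M}"
    using fc a unfolding t_finite_character_def by blast
  ultimately have fin: "finite {Q \<in> S. a \<in> Q}" by (meson finite_imageD finite_subset)
  have "\<forall>Q\<in>S. \<exists>b. b \<in> P \<and> b \<notin> Q" using neg by blast
  then obtain b where b: "\<forall>Q\<in>S. b Q \<in> P \<and> b Q \<notin> Q" by metis
  define J where "J = insert a (b ` {Q \<in> S. a \<in> Q})"
  have J: "finite J" "J \<subseteq> P" "a \<in> J" and JQ: "\<And>Q. Q \<in> S \<Longrightarrow> \<not> J \<subseteq> Q"
    using fin a b unfolding J_def by auto
  obtain M where M: "t_maximal R M" "P \<subseteq> M" using t_prime_subset_t_maximal[OF P] by blast
  obtain f s where f: "f \<in> J" "f \<noteq> 0" "s \<in> R - M" "\<forall>g\<in>J. \<exists>a\<in>R. s * g = a * f"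
    using finite_local_generator[OF M(1) J(1,3) a(2)] by blast
  have "s / f \<in> loc R Q" if Q: "Q \<in> S" for Q
  proof -
    \<comment> \<open>Such a \<open>g\<close> serves as the denominator of \<open>s / f\<close> at
      \<open>Q\<close>.\<close>
    obtain g where g: "g \<in> J" "g \<notin> Q" using JQ[OF Q] by blast
    obtain c where c: "c \<in> R" "s * g = c * f" using f(4) g by blast
    have "g \<in> R" using g J primeD(1)[OF Pp] by blast
    moreover have "g * (s / f) = c * 1" using c f(2) by (simp add: field_simps)
    ultimately have "ldvd R Q 1 (s / f)" using g c by (intro ldvdI)
    then show ?thesis using loc_iff_ldvd Sp[OF Q] by blast
  qed
  then have "s / f \<in> loc R P" using sub by blast
  then have "ldvd R P 1 (s / f)" using loc_iff_ldvd[OF Pp] by blast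
  then obtain u c where u: "u \<in> R - P" "c \<in> R" "u * (s / f) = c * 1" unfolding ldvd_def by blast
  \<comment> \<open>The left side avoids \<open>P\<close>, whereas \<open>f\<close> comes from
    \<open>J\<close> and so the right side lies in \<open>P\<close>.\<close>
  then have "s * u = c * f" using f(2) by (simp add: field_simps)
  moreover have "c * f \<in> P" using primeD(4)[OF Pp u(2)] f J by blast
  moreover have "s * u \<in> R - P" using primeD(6)[OF Pp, of s u] f u M(2) by blast
  ultimately show False by simp
qed

text \<open>Two applications of the preceding lemma give a chain P \<subseteq> Q \<subseteq> P' with
  \<open>P\<close>, \<open>P'\<close> in the first family and \<open>Q\<close> in the second;
  incomparability collapses it.\<close>

theorem finite_char_imp_t_sharp_sharp:
  assumes fc: "t_finite_character R" shows "t_sharp_sharp R"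
proof -
  have sub: "S \<subseteq> S'" if S: "incomparable_t_primes R S" "incomparable_t_primes R S'"
    and eq: "(\<Inter>P\<in>S. loc R P) = (\<Inter>P\<in>S'. loc R P)" for S S'
  proof
    fix P assume P: "P \<in> S"
    have tp: "t_prime R Q" if "Q \<in> S \<union> S'" for Q using S that unfolding incomparable_t_primes_def by blast
    have "(\<Inter>Q\<in>S'. loc R Q) \<subseteq> loc R P" unfolding eq[symmetric] using P by (rule INF_lower)
    then obtain Q where Q: "Q \<in> S'" "P \<subseteq> Q"
      using finite_char_intersection_subset_loc[OF fc S(2) tp[of P]] P by auto
    have "(\<Inter>Q\<in>S. loc R Q) \<subseteq> loc R Q" unfolding eq using Q(1) by (rule INF_lower)
    then obtain P' where P': "P' \<in> S" "Q \<subseteq> P'"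
      using finite_char_intersection_subset_loc[OF fc S(1) tp[of Q]] Q by auto
    then have "P \<subseteq> P'" using Q by blast
    then have "P = P'" using S(1) P P'(1) unfolding incomparable_t_primes_def by simp
    then have "P = Q" using P'(2) Q(2) by blast
    then show "P \<in> S'" using Q by simp
  qed
  show ?thesis unfolding t_sharp_sharp_def
  proof (intro allI impI notI)
    fix S S' assume S: "incomparable_t_primes R S \<and> incomparable_t_primes R S' \<and> S \<noteq> S'"
      and eq: "(\<Inter>P\<in>S. loc R P) = (\<Inter>P\<in>S'. loc R P)"
    have "S \<subseteq> S'" using S eq by (intro sub) auto
    moreover have "S' \<subseteq> S" using S eq by (intro sub) auto
    ultimately show False using S by blast
  qed
qed

section \<open>Finite detection of t-primes under t##\<close>

text \<open>\<open>D\<close> is the inverse of the module (1, x), which is locally principal: the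
  products of \<open>D\<close> with 1 and \<open>x\<close> lie in no t-maximal ideal and t-span 1.
  The finitely many elements of \<open>D\<close> occurring in such a relation v-generate
  \<open>D\<close>.\<close>

lemma conductor_v_finite:
  fixes x
  defines "D \<equiv> {r \<in> R. r * x \<in> R}"
  shows "\<exists>F. finite F \<and> F \<subseteq> D \<and> D \<subseteq> vclos R F"
proof -
  have "\<not> D \<union> (*) x ` D \<subseteq> M" if M: "t_maximal R M" for M
  proof -
    note prime = t_maximal_prime[OF M]
    consider "ldvd R M 1 x" | "ldvd R M x 1" using ldvd_total_t_maximal[OF M] by blast
    then show ?thesis
    proof cases
      case 1
      then obtain s a where "s \<in> R - M" "a \<in> R" "s * x = a * 1" unfolding ldvd_def by blast
      then show ?thesis unfolding D_def by auto
    next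
      case 2
      then obtain s a where s: "s \<in> R - M" "a \<in> R" "s * 1 = a * x" unfolding ldvd_def by blast
      then have "a \<in> D" "x * a \<notin> M" unfolding D_def by (auto simp: mult.commute)
      then show ?thesis by blast
    qed
  qed
  then have "1 \<in> tspan R (D \<union> (*) x ` D)"
    by (intro one_in_tspan) (auto simp: D_def mult.commute)
  then obtain G where G: "finite G" "G \<subseteq> D \<union> (*) x ` D" "1 \<in> vclos R G" by (rule tspanE)
  \<comment> \<open>Generators of \<open>G\<close> outside \<open>D\<close> have the form
    \<open>x * h\<close>; \<open>H\<close> collects the factors \<open>h\<close>.\<close>
  obtain H where H: "finite H" "H \<subseteq> D" "G - D = (*) x ` H"
    using finite_subset_image[of "G - D" "(*) x" D] G by blast
  define F where "F = (G \<inter> D) \<union> H"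
  have "D \<subseteq> vclos R F"
  proof
    fix j assume j: "j \<in> D"
    have "j * 1 \<in> vclos R F"
    proof (rule vclos_scale[OF G(3)])
      fix g assume g: "g \<in> G"
      show "j * g \<in> vclos R F"
      proof (cases "g \<in> D")
        case True
        then have "g \<in> vclos R F" using g vclos_incl[of F] by (auto simp: F_def)
        then show ?thesis using j by (intro vclos_mult) (auto simp: D_def)
      next
        case False
        then obtain h where h: "h \<in> H" "g = x * h" using g H by blast
        then have "h \<in> vclos R F" using vclos_incl[of F] by (auto simp: F_def)
        then have "(j * x) * h \<in> vclos R F" using j by (intro vclos_mult) (auto simp: D_def)
        then show ?thesis using h by (simp add: mult.assoc)
      qed
    qed
    then show "j \<in> vclos R F" by simp
  qed
  moreover have "finite F" "F \<subseteq> D" using G H by (auto simp: F_def)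
  ultimately show ?thesis by blast
qed

text \<open>Comparing \<open>S\<close> with \<open>insert P S\<close> yields an \<open>x\<close>
  whose denominators all lie in \<open>P\<close>, although every t-maximal ideal not above
  \<open>P\<close> misses one of them. Finitely many v-generators of these denominators form
  \<open>G\<close>.\<close>

lemma t_sharp_sharp_imp_finite_witness:
  assumes sharp: "t_sharp_sharp R" and P: "t_prime R P"
  shows "\<exists>G. finite G \<and> G \<subseteq> P \<and> (\<forall>N. t_maximal R N \<and> G \<subseteq> N \<longrightarrow> P \<subseteq> N)"
proof -
  have Pp: "prime_ideal_of R P" using P by (simp add: t_prime_def)
  define S where "S = {N. t_maximal R N \<and> \<not> P \<subseteq> N}"
  have tmp: "t_prime R N" if "t_maximal R N" for N
    using that t_maximal_prime t_maximalD unfolding t_prime_def by blast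
  have "P \<noteq> R" "t_ideal R P" using P by (auto simp: t_prime_def prime_ideal_of_def)
  \<comment> \<open>A t-maximal ideal contained in \<open>P\<close> equals \<open>P\<close> and is
    therefore not in \<open>S\<close>, so adjoining \<open>P\<close> keeps the family
    incomparable.\<close>
  then have "P = N" if "t_maximal R N" "N \<subseteq> P" for N using that unfolding t_maximal_def by blast
  moreover have "N = N'" if "t_maximal R N" "t_maximal R N'" "N \<subseteq> N'" for N N'
    using that unfolding t_maximal_def by blast
  ultimately have inc: "incomparable_t_primes R S" "incomparable_t_primes R (insert P S)"
    unfolding incomparable_t_primes_def S_def using tmp P by blast+
  have "P \<notin> S" unfolding S_def by blast
  then have "S \<noteq> insert P S" by blast
  then have "(\<Inter>P\<in>S. loc R P) \<noteq> (\<Inter>P\<in>insert P S. loc R P)"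
    using sharp inc unfolding t_sharp_sharp_def by blast
  then obtain x where x: "x \<in> (\<Inter>N\<in>S. loc R N)" "x \<notin> loc R P" by auto
  define D where "D = {r \<in> R. r * x \<in> R}"
  obtain F where F: "finite F" "F \<subseteq> D" "D \<subseteq> vclos R F"
    using conductor_v_finite[of x] unfolding D_def by blast
  have "D \<subseteq> P"
  proof (rule ccontr)
    assume "\<not> D \<subseteq> P"
    then obtain r where "r \<in> R" "r \<notin> P" "r * x \<in> R" unfolding D_def by blast
    then have "ldvd R P 1 x" by (intro ldvdI[of r _ "r * x"]) auto
    then show False using x loc_iff_ldvd[OF Pp] by blast
  qed
  moreover have "P \<subseteq> N" if N: "t_maximal R N" "F \<subseteq> N" for N
  proof (rule ccontr)
    assume "\<not> P \<subseteq> N"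
    then have "N \<in> S" using N by (simp add: S_def)
    then have "ldvd R N 1 x" using x loc_iff_ldvd[OF t_maximal_prime[OF N(1)]] by blast
    then obtain s where "s \<in> R - N" "s * x \<in> R" unfolding ldvd_def by auto
    moreover have "D \<subseteq> N" using F t_ideal_vclos[OF t_maximalD(1)[OF N(1)] F(1) N(2)] by blast
    ultimately show False unfolding D_def by blast
  qed
  ultimately show ?thesis using F by blast
qed

section \<open>The t-closure of I(R:I) is radical\<close>

text \<open>If the claim fails, it fails at some t-maximal \<open>M\<close>. The contradiction comes
  from an \<open>s\<close> outside \<open>M\<close> for which \<open>s * x\<close> is a single
  product in \<open>X\<close>.\<close>

lemma trace_radical:
  fixes I
  defines "X \<equiv> {a * b | a b. a \<in> I \<and> b \<in> colon R I}"
  assumes I: "ideal_of R I" "d \<in> I" "d \<noteq> 0"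
    and witness: "\<And>P. t_prime R P \<Longrightarrow>
      \<exists>G. finite G \<and> G \<subseteq> P \<and> (\<forall>N. t_maximal R N \<and> G \<subseteq> N \<longrightarrow> P \<subseteq> N)"
    and x: "x \<in> R" "x ^ n \<in> tspan R X"
  shows "x \<in> tspan R X"
proof (rule local_global, rule ccontr)
  fix M assume M: "t_maximal R M" and "\<not> (\<exists>s\<in>R - M. s * x \<in> tspan R X)"
  then have no: "s * x \<notin> tspan R X" if "s \<in> R - M" for s using that by blast
  note Mp = t_maximal_prime[OF M]
  have colonD: "y * i \<in> R" if "y \<in> colon R I" "i \<in> I" for y i using that unfolding colon_def by blast
  have x0: "x \<noteq> 0" using no[of 1] primeD(3)[OF Mp] tspan_zero by auto
  have XR: "X \<subseteq> R" 
  proof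
    fix f assume "f \<in> X"
    then obtain a b where "a \<in> I" "b \<in> colon R I" "f = a * b" unfolding X_def by blast
    then show "f \<in> R" using colonD[of b a] by (simp add: mult.commute)
  qed
  have X_no: "\<not> ldvd R M f x" if f: "f \<in> X" for f
  proof
    assume "ldvd R M f x"
    then obtain s a where "s \<in> R - M" "a \<in> R" "s * x = a * f" unfolding ldvd_def by blast
    moreover have "f \<in> tspan R X" using f tspan_incl by blast
    ultimately show False using no[of s] tspan_mult[of a f X] by auto
  qed
  then have x_dvd: "ldvd R M x f" if "f \<in> X" for f using that ldvd_total_t_maximal[OF M] by blast
  have XM: "X \<subseteq> M"
  proof (rule ccontr)
    assume "\<not> X \<subseteq> M"
    then obtain f where f: "f \<in> X" "f \<in> R - M" using XR by blast
    then have "x * f \<in> tspan R X" using tspan_incl tspan_mult[OF x(1)] by blast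
    then show False using no[OF f(2)] by (simp add: mult.commute)
  qed
  have "1 \<in> colon R I" using I(1) unfolding colon_def ideal_of_def by auto
  then have "d * 1 \<in> X" using I(2) unfolding X_def by blast
  then have dX: "d \<in> X" by simp

  define P where "P = {z \<in> R. \<exists>n. \<exists>f\<in>X. ldvd R M f (z ^ n)}"
  have P: "t_prime R P" "P \<subseteq> M"
    unfolding P_def using local_radical_t_prime[OF M XM dX I(3)] by blast+
  have Pp: "prime_ideal_of R P" using P(1) by (simp add: t_prime_def)
  obtain f0 where f0: "f0 \<in> X" "ldvd R M f0 (x ^ n)" using tspan_local[OF M x(2)] x0 by auto
  then have xP: "x \<in> P" unfolding P_def using x(1) by blast
  obtain i' y' where i': "i' \<in> I" and y': "y' \<in> colon R I" and f0_eq: "f0 = i' * y'"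
    using f0(1) unfolding X_def by blast
  have xn: "ldvd R M (i' * y') (x ^ n)" using f0(2) f0_eq by simp

  obtain G where G: "finite G" "G \<subseteq> P" "\<forall>N. t_maximal R N \<and> G \<subseteq> N \<longrightarrow> P \<subseteq> N"
    using witness[OF P(1)] by (elim exE conjE)
  have "\<exists>k. ldvd R M (x ^ n) (g ^ k)" if "g \<in> G" for g
  proof -
    have "g \<in> P" using that G(2) by blast
    then obtain m f where f: "f \<in> X" "ldvd R M f (g ^ m)" unfolding P_def by blast
    have "ldvd R M x (g ^ m)" using ldvd_trans[OF Mp x_dvd[OF f(1)] f(2)] .
    then have "ldvd R M (x ^ n) ((g ^ m) ^ n)" by (rule ldvd_power[OF Mp])
    then have "ldvd R M (x ^ n) (g ^ (m * n))" by (simp add: power_mult)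
    then show ?thesis ..
  qed
  then obtain k where k: "\<And>g. g \<in> G \<Longrightarrow> ldvd R M (x ^ n) (g ^ k g)" by metis
  define G' where "G' = (\<lambda>g. g ^ k g) ` G"
  have G'R: "G' \<subseteq> R" using G(2) primeD(1)[OF Pp] power_R unfolding G'_def by blast
  have G'N: "P \<subseteq> N" if N: "t_maximal R N" "G' \<subseteq> N" for N
  proof -
    have "G \<subseteq> N"
    proof
      fix g assume "g \<in> G"
      then have "g \<in> R" "g ^ k g \<in> N" using N(2) G(2) primeD(1)[OF Pp] by (auto simp: G'_def)
      then show "g \<in> N" by (rule prime_power[OF t_maximal_prime[OF N(1)]])
    qed
    then show ?thesis using G(3) N(1) by simp
  qed
  have G'dvd: "ldvd R M (i' * y') g" if "g \<in> G'" for g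
    using that k ldvd_trans[OF Mp xn] unfolding G'_def by blast

  \<comment> \<open>Otherwise (R_P : I) would be closed under division by x, and then 1/x would lie in R_P.\<close>
  have "\<exists>i\<in>I. \<exists>y. (\<forall>j\<in>I. ldvd R P 1 (y * j)) \<and> \<not> ldvd R P x (i * y)"
  proof (rule ccontr)
    assume "\<not> ?thesis"
    then have dvd: "ldvd R P x (i * y)" if "i \<in> I" "\<forall>j\<in>I. ldvd R P 1 (y * j)" for i y
      using that by blast
    have div: "\<forall>j\<in>I. ldvd R P 1 (y' / x ^ m * j)" for m
    proof (induction m)
      case 0
      show ?case using colonD[OF y'] primeD(3)[OF Pp] by (auto intro!: ldvdI[of 1])
    next
      case (Suc m)
      show ?case
      proof
        fix j assume "j \<in> I"
        then have "ldvd R P x (j * (y' / x ^ m))" using dvd Suc by blast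
        then have "ldvd R P (inverse x * x) (inverse x * (j * (y' / x ^ m)))" by (rule ldvd_scale)
        then show "ldvd R P 1 (y' / x ^ Suc m * j)" using x0 by (simp add: field_simps)
      qed
    qed
    \<comment> \<open>The exponent \<open>Suc n\<close> exceeds \<open>n\<close> by one:
      \<open>x ^ Suc n\<close> would divide \<open>i' * y'\<close>, hence \<open>x ^ n\<close>,
      making \<open>x\<close> a unit at \<open>P\<close>.\<close>
    have "ldvd R P 1 (y' / x ^ Suc n * i')" using div[of "Suc n"] i' by blast
    then have "ldvd R P (x ^ Suc n * 1) (x ^ Suc n * (y' / x ^ Suc n * i'))" by (rule ldvd_scale)
    then have "ldvd R P (x ^ Suc n) (i' * y')" using x0 by (simp add: mult.commute)
    then have "ldvd R P (x ^ Suc n) (x ^ n)" using ldvd_trans[OF Pp] ldvd_subset[OF xn P(2)] by blast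
    then obtain s a where s: "s \<in> R - P" "a \<in> R" "s * x ^ n = a * x ^ Suc n" unfolding ldvd_def by blast
    then have "s = a * x" using x0 by simp
    then show False using s primeD(4)[OF Pp s(2) xP] by blast
  qed
  then obtain i y where i: "i \<in> I" and y: "\<And>j. j \<in> I \<Longrightarrow> ldvd R P 1 (y * j)"
    and "\<not> ldvd R P x (i * y)" by blast
  \<comment> \<open>Now \<open>x / i = (p / u) * y\<close>, and \<open>p / u\<close> lies in P R_P,
    so x / i multiplies \<open>I\<close> into P R_P.\<close>
  then obtain p u where p: "p \<in> P" and u: "u \<in> R - P" and ux: "u * x = p * (i * y)"
    using not_ldvdD[OF P(1)] by blast
  have u0: "u \<noteq> 0" using u primeD(2)[OF Pp] by auto
  then have i0: "i \<noteq> 0" using ux x0 by auto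
  \<comment> \<open>The product lies in P R_P, which is contained in R_N for every t-maximal
    \<open>N\<close> above \<open>P\<close>.\<close>
  have PN: "ldvd R N 1 (e * (p / u * (y * j)))" if N: "t_maximal R N" "P \<subseteq> N" and e: "e \<in> R" and j: "j \<in> I" for N e j
  proof -
    obtain v b where v: "v \<in> R - P" "b \<in> R" "v * (y * j) = b * 1" using y[OF j] unfolding ldvd_def by blast
    have v0: "v \<noteq> 0" using v primeD(2)[OF Pp] by auto
    have "(e * b) * p \<in> P" using primeD(4)[OF Pp mult_R[OF e v(2)] p] .
    then have "ldvd R N (u * v) ((e * b) * p)"
      using ldvd_of_mem_prime[OF N(1) Pp N(2)] primeD(6)[OF Pp u v(1)] by blast
    then have "ldvd R N (inverse (u * v) * (u * v)) (inverse (u * v) * ((e * b) * p))" by (rule ldvd_scale)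
    moreover have "b = v * (y * j)" using v(3) by simp
    ultimately show ?thesis using u0 v0 by (simp add: field_simps)
  qed

  \<comment> \<open>Up to a denominator, \<open>x * g\<close> is \<open>i * y'\<close> times the
    quantity \<open>a * (p / u * (y * i'))\<close>, which lies in R_M by \<open>PN\<close>.\<close>
  have "ldvd R M (i * y') (x * g)" if g: "g \<in> G'" for g
  proof -
    obtain r a where r: "r \<in> R - M" "a \<in> R" "r * g = a * (i' * y')"
      using G'dvd[OF g] unfolding ldvd_def by blast
    have "ldvd R M 1 (a * (p / u * (y * i')))" using PN[OF M P(2) r(2) i'] .
    then have dvd: "ldvd R M ((i * y') * 1) ((i * y') * (a * (p / u * (y * i'))))" by (rule ldvd_scale)
    have "(i * y') * (a * (p / u * (y * i'))) = (p * (i * y)) / u * (a * (i' * y'))"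
      by (simp add: field_simps)
    also have "\<dots> = r * (x * g)" unfolding ux[symmetric] r(3)[symmetric] using u0 by simp
    finally have 1: "ldvd R M (i * y') (r * (x * g))" using dvd by simp
    have "ldvd R M (r * (x * g)) (x * g)" using r(1) by (intro ldvdI[of r _ 1]) auto
    then show ?thesis using 1 ldvd_trans[OF Mp] by blast
  qed
  then have "\<exists>s\<in>R - M. \<forall>h\<in>(*) x ` G'. \<exists>a\<in>R. s * h = a * (i * y')"
    using G(1) by (intro ldvd_common_denominator[OF Mp]) (auto simp: G'_def)
  then obtain s where s: "s \<in> R - M" "\<And>g. g \<in> G' \<Longrightarrow> \<exists>a\<in>R. s * (x * g) = a * (i * y')" by blast

  \<comment> \<open>\<open>c\<close> multiplies \<open>I\<close> into R: above \<open>P\<close> this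
    follows from \<open>PN\<close>, and elsewhere some \<open>g\<close> in \<open>G'\<close> outside
    \<open>N\<close> is a denominator, since \<open>s * (x * g)\<close> is a multiple of
    \<open>i * y'\<close> in R.\<close>
  define c where "c = s * x / i"
  have "c * j \<in> R" if j: "j \<in> I" for j
  proof (rule local_global_R)
    fix N assume N: "t_maximal R N"
    show "ldvd R N 1 (c * j)"
    proof (cases "P \<subseteq> N")
      case True
      have "x = p * (i * y) / u" using ux u0 by (simp add: field_simps)
      then have "c * j = s * (p / u * (y * j))" unfolding c_def using i0 by (simp add: field_simps)
      then show ?thesis using PN[OF N True _ j, of s] s(1) by simp
    next
      case False
      then obtain g where g: "g \<in> G'" "g \<notin> N" using G'N[OF N] by blast
      obtain a where a: "a \<in> R" "s * (x * g) = a * (i * y')" using s(2)[OF g(1)] by blast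
      have "g * (c * j) = (s * (x * g)) / i * j" unfolding c_def by (simp add: field_simps)
      also have "\<dots> = a * (y' * j) * 1" unfolding a(2) using i0 by simp
      finally have "g * (c * j) = a * (y' * j) * 1" .
      moreover have "g \<in> R" using g(1) G'R by blast
      ultimately show ?thesis using g(2) mult_R[OF a(1) colonD[OF y' j]] by (intro ldvdI[of g])
    qed
  qed
  then have "c \<in> colon R I" unfolding colon_def by blast
  then have "i * c \<in> X" using i unfolding X_def by blast
  moreover have "i * c = s * x" unfolding c_def using i0 by simp
  ultimately show False using no[OF s(1)] tspan_incl[of X] by auto
qed

theorem t_sharp_sharp_imp_tRTP:
  assumes "t_sharp_sharp R" shows "tRTP R"
  unfolding tRTP_def Let_def
proof (intro allI impI disjI2)
  fix I assume "ideal_of R I \<and> I \<noteq> {0}"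
  then obtain d where I: "ideal_of R I" "d \<in> I" "d \<noteq> 0"
    unfolding ideal_of_def submod_def by blast
  have "1 \<in> colon R I" using I(1) unfolding colon_def ideal_of_def by auto
  then have eq: "tclos R (mprod R I (colon R I)) = tspan R {a * b | a b. a \<in> I \<and> b \<in> colon R I}"
    using I by (intro tclos_mprod[of d _ 1]) auto
  show "radical_ideal R (tclos R (mprod R I (colon R I)))"
    unfolding eq radical_ideal_def
    using trace_radical[OF I t_sharp_sharp_imp_finite_witness[OF assms]] by blast
qed

section \<open>From tRTP to finite character\<close>

text \<open>For I = x^2 R_M \<inter> R, the condition tRTP places \<open>x\<close> in the t-closure
  of I(R:I). Hence some product from I(R:I) divides \<open>x\<close> in R_M, and cancellation leaves
  a multiple of its second factor as the inverse of \<open>x\<close> up to a unit of R_M.\<close>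

lemma tRTP_separating_element:
  assumes tRTP: "tRTP R" and unique: "unique_t_max R"
    and M: "t_maximal R M" and x: "x \<in> M" "x \<noteq> 0"
  shows "\<exists>y. x * y \<in> R - M \<and> (\<forall>N. t_maximal R N \<and> N \<noteq> M \<longrightarrow> ldvd R N 1 y)"
proof -
  note Mp = t_maximal_prime[OF M]
  have xR: "x \<in> R" using x primeD(1)[OF Mp] by blast
  define I where "I = {z \<in> R. ldvd R M (x * x) z}"
  have I: "ideal_of R I" unfolding ideal_of_def submod_def
  proof (intro conjI ballI)
    show "I \<subseteq> R" unfolding I_def by blast
    show "0 \<in> I" unfolding I_def using primeD(3)[OF Mp] by (auto intro: ldvdI[of 1 _ 0])
    show "a + b \<in> I" if "a \<in> I" "b \<in> I" for a b
      using that ldvd_add[OF Mp] add_R unfolding I_def by blast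
    fix r a assume ra: "r \<in> R" "a \<in> I"
    then have "ldvd R M a (r * a)" using primeD(3)[OF Mp] by (intro ldvdI[of 1 _ r]) auto
    then show "r * a \<in> I" using ra ldvd_trans[OF Mp] mult_R unfolding I_def by blast
  qed
  have xxI: "x * x \<in> I" using xR mult_R ldvd_refl[OF Mp] unfolding I_def by blast
  \<comment> \<open>Any such \<open>N\<close> contains the t-prime \<open>P\<close> given by the
    radical of x R_M; uniqueness of the t-maximal ideal above \<open>P\<close> forces
    \<open>N = M\<close>.\<close>
  have I_sub: "N = M" if N: "t_maximal R N" "I \<subseteq> N" for N
  proof -
    define P where "P = {z \<in> R. \<exists>n. \<exists>f\<in>{x}. ldvd R M f (z ^ n)}"
    have P: "t_prime R P" "P \<subseteq> M"
      unfolding P_def using local_radical_t_prime[OF M, of "{x}" x] x by auto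
    have "P \<subseteq> N"
    proof
      fix z assume "z \<in> P"
      then obtain n where z: "z \<in> R" "ldvd R M x (z ^ n)" unfolding P_def by blast
      have "ldvd R M (x * x) (z ^ (n + n))" using ldvd_mult[OF Mp z(2) z(2)] by (simp add: power_add)
      then have "z ^ (n + n) \<in> N" using N(2) z(1) power_R unfolding I_def by blast
      then show "z \<in> N" using prime_power[OF t_maximal_prime[OF N(1)] z(1)] by blast
    qed
    then show ?thesis using unique P M N(1) unfolding unique_t_max_def by blast
  qed
  let ?X = "{a * b | a b. a \<in> I \<and> b \<in> colon R I}"
  have one: "1 \<in> colon R I" using I unfolding colon_def ideal_of_def by auto
  have eq: "tclos R (mprod R I (colon R I)) = tspan R ?X"
    using xxI one x by (intro tclos_mprod[of "x * x" _ 1]) auto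
  have "I \<noteq> {0}" using xxI x by auto
  then have "tspan R ?X = R \<or> radical_ideal R (tspan R ?X)"
    using tRTP I eq unfolding tRTP_def Let_def by metis
  then have "x \<in> tspan R ?X"
  proof
    assume "tspan R ?X = R" then show ?thesis using xR by simp
  next
    assume rad: "radical_ideal R (tspan R ?X)"
    have "x * x * 1 \<in> ?X" using xxI one by blast
    then have "x ^ 2 \<in> tspan R ?X" using tspan_incl[of ?X] by (auto simp: power2_eq_square)
    then show ?thesis using rad xR unfolding radical_ideal_def by (meson zero_less_numeral)
  qed
  then obtain f where "f \<in> ?X" "ldvd R M f x" using tspan_local[OF M _ x(2)] by blast
  then obtain i y where i: "i \<in> I" and y: "y \<in> colon R I" and iy: "ldvd R M (i * y) x" by blast
  obtain s a where s: "s \<in> R - M" "a \<in> R" "s * x = a * (i * y)" using iy unfolding ldvd_def by blast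
  obtain t b where t: "t \<in> R - M" "b \<in> R" "t * i = b * (x * x)" using i unfolding I_def ldvd_def by blast
  have "x * (s * t) = t * (s * x)" by (simp add: algebra_simps)
  also have "\<dots> = a * y * (t * i)" unfolding s(3) by (simp add: algebra_simps)
  also have "\<dots> = x * (x * (a * b * y))" unfolding t(3) by (simp add: algebra_simps)
  finally have st: "s * t = x * (a * b * y)" using x(2) by simp
  have "x * (a * b * y) \<in> R - M" unfolding st[symmetric] using primeD(6)[OF Mp s(1) t(1)] .
  moreover have "ldvd R N 1 (a * b * y)" if N: "t_maximal R N" "N \<noteq> M" for N
  proof -
    \<comment> \<open>\<open>j\<close> is a denominator for \<open>y\<close> at \<open>N\<close>,
      because \<open>y\<close> multiplies \<open>I\<close> into R.\<close>
    obtain j where j: "j \<in> I" "j \<notin> N" using I_sub[OF N(1)] N(2) by blast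
    have "y * j \<in> R" using y j(1) unfolding colon_def by blast
    then have "a * b * (y * j) \<in> R" using s t mult_R by blast
    moreover have "j * (a * b * y) = a * b * (y * j) * 1" by (simp add: algebra_simps)
    moreover have "j \<in> R" using j(1) unfolding I_def by blast
    ultimately show ?thesis using j(2) by (intro ldvdI[of j])
  qed
  ultimately show ?thesis by blast
qed

theorem tRTP_imp_finite_char:
  assumes tRTP: "tRTP R" and unique: "unique_t_max R"
  shows "t_finite_character R"
  unfolding t_finite_character_def
proof (intro ballI impI)
  fix x assume x: "x \<in> R" "x \<noteq> 0"
  let ?S = "{M. t_maximal R M \<and> x \<in> M}"
  have "\<forall>M\<in>?S. \<exists>y. x * y \<in> R - M \<and> (\<forall>N. t_maximal R N \<and> N \<noteq> M \<longrightarrow> ldvd R N 1 y)"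
    using tRTP_separating_element[OF tRTP unique _ _ x(2)] by blast
  then obtain y where y: "\<And>M. M \<in> ?S \<Longrightarrow> x * y M \<in> R - M"
    and y_loc: "\<And>M N. M \<in> ?S \<Longrightarrow> t_maximal R N \<Longrightarrow> N \<noteq> M \<Longrightarrow> ldvd R N 1 (y M)"
    by metis
  \<comment> \<open>\<open>z M\<close> avoids \<open>M\<close> but lies in every other t-maximal
    ideal containing \<open>x\<close>.\<close>
  define z where "z M = x * y M" for M
  have zN: "z M \<in> N" if M: "M \<in> ?S" and N: "N \<in> ?S" "N \<noteq> M" for M N
  proof -
    note Np = t_maximal_prime[of N]
    obtain s a where s: "s \<in> R - N" "a \<in> R" "s * y M = a * 1"
      using y_loc[OF M _ N(2)] N(1) unfolding ldvd_def by blast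
    then have "s * z M = a * x" unfolding z_def by (simp add: algebra_simps)
    moreover have "a * x \<in> N" using N(1) s(2) primeD(4)[OF Np] by blast
    moreover have "z M \<in> R" using y[OF M] unfolding z_def by blast
    ultimately show ?thesis using primeD(5)[OF Np, of s "z M"] s(1) N(1) by auto
  qed
  \<comment> \<open>A t-maximal ideal either misses \<open>x\<close> or belongs to \<open>?S\<close>
    and misses its own \<open>z M\<close>.\<close>
  have "1 \<in> tspan R (insert x (z ` ?S))"
  proof (rule one_in_tspan)
    show "insert x (z ` ?S) \<subseteq> R" using x y unfolding z_def by blast
    show "\<not> insert x (z ` ?S) \<subseteq> M" if "t_maximal R M" for M
      using that y[of M] unfolding z_def by blast
  qed
  then obtain G where G: "finite G" "G \<subseteq> insert x (z ` ?S)" "1 \<in> vclos R G" by (rule tspanE)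
  \<comment> \<open>If \<open>z N\<close> were absent from \<open>G\<close>, all of \<open>G\<close>
    would lie in \<open>N\<close>, and then so would 1.\<close>
  have "z ` ?S \<subseteq> G"
  proof (rule image_subsetI, rule ccontr)
    fix N assume N: "N \<in> ?S" "z N \<notin> G"
    have "G \<subseteq> N"
    proof
      fix g assume "g \<in> G"
      then consider "g = x" | M where "M \<in> ?S" "g = z M" using G(2) by blast
      then show "g \<in> N"
      proof cases
        case 1
        then show ?thesis using N by simp
      next
        case 2
        then have "N \<noteq> M" using N(2) \<open>g \<in> G\<close> by blast
        then show ?thesis using zN[OF 2(1) N(1)] 2(2) by blast
      qed
    qed
    then show False using t_ideal_vclos[of N G] t_maximalD[of N] N(1) G by blast
  qed
  then have "finite (z ` ?S)" using G(1) finite_subset by blast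
  moreover have "inj_on z ?S"
  proof (rule inj_onI, rule ccontr)
    fix M N assume MN: "M \<in> ?S" "N \<in> ?S" "z M = z N" "M \<noteq> N"
    then have "z M \<in> N" using zN[of M N] by blast
    then show False using y[OF MN(2)] MN(3) unfolding z_def by simp
  qed
  ultimately show "finite ?S" by (rule finite_imageD)
qed

end

theorem theorem1p12:
  fixes R :: "'a::field set"
  assumes "domain_with_qf R" and "PvMD R"
  shows "(weakly_Matlis R \<longrightarrow> t_finite_character R) \<and>
         (t_finite_character R \<longrightarrow> t_sharp_sharp R) \<and>
         (t_sharp_sharp R \<longrightarrow> tRTP R) \<and>
         (unique_t_max R \<longrightarrow>
            ((weakly_Matlis R \<longleftrightarrow> t_finite_character R) \<and>
             (t_finite_character R \<longleftrightarrow> t_sharp_sharp R) \<and>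
             (t_sharp_sharp R \<longleftrightarrow> tRTP R)))"
proof -
  interpret PvMD_domain R using assms by unfold_locales
  show ?thesis
    using finite_char_imp_t_sharp_sharp t_sharp_sharp_imp_tRTP tRTP_imp_finite_char
    unfolding weakly_Matlis_def by blast
qed

end
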